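(* Let $m\ge 1$, $\mathbf N=(N_1,\dots,N_m)$ with every $N_\nu\ge 3$, $\mathbb T_{\mathbf N}=\prod_{\nu=1}^m\mathbb Z/N_\nu\mathbb Z$, let $q:\mathbb T_{\mathbf N}\to\mathbb R$, $r_\nu^{\pm}:\mathbb T_{\mathbf N}\to(0,\infty)$, and $$(\mathcal M u)(x)=q_xu(x)+\sum_{\nu=1}^m\left[r_\nu^+(x)u(x+e_\nu)+r_\nu^-(x)u(x-e_\nu)\right].$$ With the notation of the context: (i) For every $a\in\mathcal P_{\mathbf N}$ the functional $\beta\mapsto\mathcal F_{\mathcal M}(a,\beta)$ has a unique minimizer in $\mathcal Z_{\mathbf N}$. (ii) Let $\phi,\psi$ be positive vectors with $\mathcal M\phi=\Lambda(\mathcal M)\phi$ and $\mathcal M^{\mathsf T}\psi=\Lambda(\mathcal M)\psi$, scaled so that $\sum_x\phi_x\psi_x=1$ and $\sum_x\log(\phi_x/\psi_x)=0$. Put $a_x=\sqrt{\phi_x\psi_x}$ and $\beta_x=\frac12\log(\phi_x/\psi_x)$. Then $(a,\beta)\in\mathcal P_{\mathbf N}\times\mathcal Z_{\mathbf N}$ is a saddle point with value $\Lambda(\mathcal M)$: $$\mathcal F_{\mathcal M}(b,\beta)\le\mathcal F_{\mathcal M}(a,\beta)=\Lambda(\mathcal M)\le\mathcal F_{\mathcal M}(a,\eta)\qquad\text{for all } b\in\mathcal P_{\mathbf N},\ \eta\in\mathcal Z_{\mathbf N}.$$ (iii) For $a\in\mathcal P_{\mathbf N}$, if $\beta$ is the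 minimizer of $\mathcal F_{\mathcal M}(a,\cdot)$ over $\mathcal Z_{\mathbf N}$, then the edge flux $$J_{x,\nu}:=\kappa_{x,\nu}a_xa_{x+e_\nu}\sinh\bigl(\beta_{x+e_\nu}-\beta_x+\gamma_{x,\nu}\bigr)$$ is divergence-free, i.e. $\sum_{\nu=1}^m(J_{x,\nu}-J_{x-e_\nu,\nu})=0$ for every $x\in\mathbb T_{\mathbf N}$.
   Context: Here $e_\nu$ is the $\nu$-th standard unit vector and site arithmetic is periodic (modulo $N_\nu$ in coordinate $\nu$). The matrix of $\mathcal M$ is irreducible and Metzler (nonnegative off-diagonal entries); its principal eigenvalue $\Lambda(\mathcal M)$ is its spectral bound (largest real part of an eigenvalue), which is a real, algebraically simple eigenvalue with positive right and left eigenvectors. For each $x\in\mathbb T_{\mathbf N}$ and $1\le\nu\le m$, $$\kappa_{x,\nu}:=\sqrt{r_\nu^+(x)\,r_\nu^-(x+e_\nu)},\qquad \gamma_{x,\nu}:=\frac12\log\frac{r_\nu^+(x)}{r_\nu^-(x+e_\nu)}.$$ $\mathcal P_{\mathbf N}:=\{a:\mathbb T_{\mathbf N}\to(0,\infty):\sum_xa_x^2=1\}$ and $\mathcal Z_{\mathbf N}:=\{\beta:\mathbb T_{\mathbf N}\to\mathbb R:\sum_x\beta_x=0\}$. For $a\in\mathcal P_{\mathbf N}$, $\beta\in\mathcal Z_{\mathbf N}$, $$\mathcal F_{\mathcal M}(a,\beta):=\sum_xq_xa_x^2+2\sum_{x,\nu}\kappa_{x,\nu}a_xa_{x+e_\nu}\cosh\bigl(\beta_{x+e_\nu}-\beta_x+\gamma_{x,\nu}\bigr),$$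 where $\sum_{x,\nu}$ runs over $x\in\mathbb T_{\mathbf N}$, $1\le\nu\le m$. *)

theory Defs
  imports Complex_Main "HOL-Library.FuncSet"
begin

type_synonym site = "nat \<Rightarrow> int"

(* The residue class group Z/N_nu is represented by its canonical representatives 0, ..., N_nu - 1. *)
definition torus :: "nat \<Rightarrow> (nat \<Rightarrow> nat) \<Rightarrow> site set" where
  "torus m N = (\<Pi>\<^sub>E \<nu>\<in>{1..m}. {0..<int (N \<nu>)})"

(* shift N \<nu> k x is x + k e_nu, computed modulo N_nu. *)
definition shift :: "(nat \<Rightarrow> nat) \<Rightarrow> nat \<Rightarrow> int \<Rightarrow> site \<Rightarrow> site" where
  "shift N \<nu> k x = x(\<nu> := (x \<nu> + k) mod int (N \<nu>))"

definition generator ::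
  "nat \<Rightarrow> (nat \<Rightarrow> nat) \<Rightarrow> (site \<Rightarrow> real) \<Rightarrow> (nat \<Rightarrow> site \<Rightarrow> real) \<Rightarrow> (nat \<Rightarrow> site \<Rightarrow> real)
    \<Rightarrow> (site \<Rightarrow> real) \<Rightarrow> site \<Rightarrow> real" where
  "generator m N q rp rm u x =
     q x * u x + (\<Sum>\<nu>=1..m. rp \<nu> x * u (shift N \<nu> 1 x) + rm \<nu> x * u (shift N \<nu> (-1) x))"

definition matrix_entry :: "(('a \<Rightarrow> real) \<Rightarrow> 'a \<Rightarrow> real) \<Rightarrow> 'a \<Rightarrow> 'a \<Rightarrow> real" where
  "matrix_entry L x y = L (\<lambda>z. if z = y then 1 else 0) x"

definition transpose_op ::
  "'a set \<Rightarrow> (('a \<Rightarrow> real) \<Rightarrow> 'a \<Rightarrow> real) \<Rightarrow> ('a \<Rightarrow> real) \<Rightarrow> 'a \<Rightarrow> real" where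
  "transpose_op S L u x = (\<Sum>y\<in>S. matrix_entry L y x * u y)"

(* Complex eigenvalues of the real S-by-S matrix of L. *)
definition eigenvalue_on :: "'a set \<Rightarrow> (('a \<Rightarrow> real) \<Rightarrow> 'a \<Rightarrow> real) \<Rightarrow> complex \<Rightarrow> bool" where
  "eigenvalue_on S L \<mu> \<longleftrightarrow>
     (\<exists>v :: 'a \<Rightarrow> complex. (\<exists>x\<in>S. v x \<noteq> 0) \<and>
        (\<forall>x\<in>S. (\<Sum>y\<in>S. complex_of_real (matrix_entry L x y) * v y) = \<mu> * v x))"

(* For finite nonempty S the set of eigenvalues is finite and nonempty, so Max is the true maximum. *)
definition spectral_bound :: "'a set \<Rightarrow> (('a \<Rightarrow> real) \<Rightarrow> 'a \<Rightarrow> real) \<Rightarrow> real" where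
  "spectral_bound S L = Max (Re ` {\<mu>. eigenvalue_on S L \<mu>})"

definition kappa ::
  "(nat \<Rightarrow> nat) \<Rightarrow> (nat \<Rightarrow> site \<Rightarrow> real) \<Rightarrow> (nat \<Rightarrow> site \<Rightarrow> real) \<Rightarrow> site \<Rightarrow> nat \<Rightarrow> real" where
  "kappa N rp rm x \<nu> = sqrt (rp \<nu> x * rm \<nu> (shift N \<nu> 1 x))"

definition gam ::
  "(nat \<Rightarrow> nat) \<Rightarrow> (nat \<Rightarrow> site \<Rightarrow> real) \<Rightarrow> (nat \<Rightarrow> site \<Rightarrow> real) \<Rightarrow> site \<Rightarrow> nat \<Rightarrow> real" where
  "gam N rp rm x \<nu> = (1/2) * ln (rp \<nu> x / rm \<nu> (shift N \<nu> 1 x))"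

(* Functions on the torus are taken extensional, so that equality (and hence uniqueness
   of minimizers) is equality of the values on the torus. *)
definition amplitudes :: "nat \<Rightarrow> (nat \<Rightarrow> nat) \<Rightarrow> (site \<Rightarrow> real) set" where
  "amplitudes m N = {a \<in> torus m N \<rightarrow>\<^sub>E {0<..}. (\<Sum>x\<in>torus m N. (a x)\<^sup>2) = 1}"

definition potentials :: "nat \<Rightarrow> (nat \<Rightarrow> nat) \<Rightarrow> (site \<Rightarrow> real) set" where
  "potentials m N = {\<beta> \<in> torus m N \<rightarrow>\<^sub>E UNIV. (\<Sum>x\<in>torus m N. \<beta> x) = 0}"

definition saddle_functional ::
  "nat \<Rightarrow> (nat \<Rightarrow> nat) \<Rightarrow> (site \<Rightarrow> real) \<Rightarrow> (nat \<Rightarrow> site \<Rightarrow> real) \<Rightarrow> (nat \<Rightarrow> site \<Rightarrow> real)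
    \<Rightarrow> (site \<Rightarrow> real) \<Rightarrow> (site \<Rightarrow> real) \<Rightarrow> real" where
  "saddle_functional m N q rp rm a \<beta> =
     (\<Sum>x\<in>torus m N. q x * (a x)\<^sup>2) +
     2 * (\<Sum>x\<in>torus m N. \<Sum>\<nu>=1..m. kappa N rp rm x \<nu> * a x * a (shift N \<nu> 1 x) *
            cosh (\<beta> (shift N \<nu> 1 x) - \<beta> x + gam N rp rm x \<nu>))"

definition edge_flux ::
  "(nat \<Rightarrow> nat) \<Rightarrow> (nat \<Rightarrow> site \<Rightarrow> real) \<Rightarrow> (nat \<Rightarrow> site \<Rightarrow> real)
    \<Rightarrow> (site \<Rightarrow> real) \<Rightarrow> (site \<Rightarrow> real) \<Rightarrow> site \<Rightarrow> nat \<Rightarrow> real" where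
  "edge_flux N rp rm a \<beta> x \<nu> =
     kappa N rp rm x \<nu> * a x * a (shift N \<nu> 1 x) *
       sinh (\<beta> (shift N \<nu> 1 x) - \<beta> x + gam N rp rm x \<nu>)"

end

(* Since rp = kappa * exp gam and rm (shifted) = kappa * exp (- gam), the functional is the conjugated
   quadratic form F(b, eta) = sum_{x,y} M_xy b_x exp(-eta_x) b_y exp(eta_y). At the eigenvector pair,
   writing b = c a turns it into sum c_x psi_x M_xy phi_y c_y, which 2 c_x c_y <= c_x^2 + c_y^2 bounds
   from above by Lambda; writing eta = beta + d turns F(a, eta) into
   sum psi_x M_xy phi_y exp(d_y - d_x), which exp t >= 1 + t bounds from below by Lambda.
   F(a, .) depends only on the edge differences of beta, is strictly convex in them and bounds them on
   sublevel sets; as the torus is connected this gives existence and uniqueness of the minimizer up to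
   a constant. Hence a minimizer over mean-zero potentials is a global one, and vanishing of the
   derivative in the direction of a single site is the divergence condition there. *)

theory Submission
  imports Defs "HOL-Analysis.Function_Topology"
begin

section \<open>Two-sided bounds for Metzler forms at an eigenvector pair\<close>

text \<open>Off the diagonal the weight \<open>A x y * \<psi> x * \<phi> y\<close> is nonnegative,
  so the arithmetic-geometric inequality for \<open>c x * c y\<close> may be applied entry by entry;
  on the diagonal it is an equality, whatever the sign of \<open>A x x\<close>.\<close>

lemma metzler_form_le:
  fixes A :: "'a \<Rightarrow> 'a \<Rightarrow> real"
  assumes metzler: "\<And>x y. x \<in> S \<Longrightarrow> y \<in> S \<Longrightarrow> x \<noteq> y \<Longrightarrow> A x y \<ge> 0"
    and pos: "\<And>x. x \<in> S \<Longrightarrow> \<phi> x \<ge> 0 \<and> \<psi> x \<ge> 0"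
    and right: "\<And>x. x \<in> S \<Longrightarrow> (\<Sum>y\<in>S. A x y * \<phi> y) = \<Lambda> * \<phi> x"
    and left: "\<And>y. y \<in> S \<Longrightarrow> (\<Sum>x\<in>S. A x y * \<psi> x) = \<Lambda> * \<psi> y"
  shows "(\<Sum>x\<in>S. \<Sum>y\<in>S. A x y * (c x * \<psi> x) * (c y * \<phi> y))
      \<le> \<Lambda> * (\<Sum>x\<in>S. (c x)\<^sup>2 * (\<phi> x * \<psi> x))"
proof -
  have entry: "A x y * (c x * \<psi> x) * (c y * \<phi> y)
      \<le> A x y * \<psi> x * \<phi> y * (((c x)\<^sup>2 + (c y)\<^sup>2) / 2)" if "x \<in> S" "y \<in> S" for x y
  proof (cases "x = y")
    case True
    then show ?thesis by (simp add: power2_eq_square)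
  next
    case False
    have "c x * c y \<le> ((c x)\<^sup>2 + (c y)\<^sup>2) / 2"
      using sum_squares_bound[of "c x" "c y"] by simp
    moreover have "0 \<le> A x y * \<psi> x * \<phi> y"
      using metzler[OF that False] pos that by simp
    ultimately have "A x y * \<psi> x * \<phi> y * (c x * c y) \<le> A x y * \<psi> x * \<phi> y * (((c x)\<^sup>2 + (c y)\<^sup>2) / 2)"
      by (rule mult_left_mono)
    then show ?thesis by (simp add: mult_ac)
  qed
  have "(\<Sum>x\<in>S. \<Sum>y\<in>S. A x y * (c x * \<psi> x) * (c y * \<phi> y))
      \<le> (\<Sum>x\<in>S. \<Sum>y\<in>S. A x y * \<psi> x * \<phi> y * (((c x)\<^sup>2 + (c y)\<^sup>2) / 2))"
    by (intro sum_mono entry)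
  \<comment> \<open>Each square involves only one of the two indices, so summing over the other one
    is an eigenvector equation: the right one for \<open>x\<close>, the left one for
    \<open>y\<close>.\<close>
  also have "\<dots> = (\<Sum>x\<in>S. \<Sum>y\<in>S. A x y * \<phi> y * (\<psi> x * (c x)\<^sup>2 / 2))
      + (\<Sum>x\<in>S. \<Sum>y\<in>S. A x y * \<psi> x * (\<phi> y * (c y)\<^sup>2 / 2))"
    by (simp add: sum.distrib[symmetric] field_simps)
  also have "(\<Sum>x\<in>S. \<Sum>y\<in>S. A x y * \<psi> x * (\<phi> y * (c y)\<^sup>2 / 2))
      = (\<Sum>y\<in>S. \<Sum>x\<in>S. A x y * \<psi> x * (\<phi> y * (c y)\<^sup>2 / 2))"
    by (rule sum.swap)
  also have "(\<Sum>x\<in>S. \<Sum>y\<in>S. A x y * \<phi> y * (\<psi> x * (c x)\<^sup>2 / 2)) + \<dots>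
      = (\<Sum>x\<in>S. \<Lambda> * \<phi> x * (\<psi> x * (c x)\<^sup>2 / 2)) + (\<Sum>y\<in>S. \<Lambda> * \<psi> y * (\<phi> y * (c y)\<^sup>2 / 2))"
    unfolding sum_distrib_right[symmetric] using right left by simp
  also have "\<dots> = \<Lambda> * (\<Sum>x\<in>S. (c x)\<^sup>2 * (\<phi> x * \<psi> x))"
    by (simp add: sum.distrib[symmetric] sum_distrib_left field_simps)
  finally show ?thesis .
qed

text \<open>The tangent bound for \<open>exp\<close> at 0 is applied to \<open>d y - d x\<close>
  entry by entry, again with equality on the diagonal. The terms linear in \<open>d\<close> cancel,
  because the right and the left eigenvector equation produce them with opposite signs.\<close>

lemma metzler_form_ge:
  fixes A :: "'a \<Rightarrow> 'a \<Rightarrow> real"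
  assumes metzler: "\<And>x y. x \<in> S \<Longrightarrow> y \<in> S \<Longrightarrow> x \<noteq> y \<Longrightarrow> A x y \<ge> 0"
    and pos: "\<And>x. x \<in> S \<Longrightarrow> \<phi> x \<ge> 0 \<and> \<psi> x \<ge> 0"
    and right: "\<And>x. x \<in> S \<Longrightarrow> (\<Sum>y\<in>S. A x y * \<phi> y) = \<Lambda> * \<phi> x"
    and left: "\<And>y. y \<in> S \<Longrightarrow> (\<Sum>x\<in>S. A x y * \<psi> x) = \<Lambda> * \<psi> y"
  shows "\<Lambda> * (\<Sum>x\<in>S. \<phi> x * \<psi> x)
      \<le> (\<Sum>x\<in>S. \<Sum>y\<in>S. A x y * (\<psi> x * exp (- d x)) * (\<phi> y * exp (d y)))"
proof -
  have entry: "A x y * \<psi> x * \<phi> y * (1 + d y - d x)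
      \<le> A x y * (\<psi> x * exp (- d x)) * (\<phi> y * exp (d y))" if "x \<in> S" "y \<in> S" for x y
  proof (cases "x = y")
    case True
    then show ?thesis by (simp add: exp_minus mult_ac)
  next
    case False
    have "1 + d y - d x \<le> exp (- d x) * exp (d y)"
      using exp_ge_add_one_self[of "d y - d x"] by (simp add: exp_add[symmetric] algebra_simps)
    moreover have "0 \<le> A x y * \<psi> x * \<phi> y"
      using metzler[OF that False] pos that by simp
    ultimately have "A x y * \<psi> x * \<phi> y * (1 + d y - d x)
        \<le> A x y * \<psi> x * \<phi> y * (exp (- d x) * exp (d y))"
      by (rule mult_left_mono)
    then show ?thesis by (simp add: mult_ac)
  qed
  \<comment> \<open>The weight 1 is split as \<open>(1 - d x) + d x\<close>: expanding the first
    part by rows and the second by columns gives the factor \<open>1 + d y - d x\<close> in each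
    entry.\<close>
  have "\<Lambda> * (\<Sum>x\<in>S. \<phi> x * \<psi> x) = (\<Sum>x\<in>S. \<Lambda> * \<phi> x * (\<psi> x * (1 - d x))) + (\<Sum>y\<in>S. \<Lambda> * \<psi> y * (\<phi> y * d y))"
    by (simp add: sum.distrib[symmetric] sum_distrib_left algebra_simps)
  also have "\<dots> = (\<Sum>x\<in>S. \<Sum>y\<in>S. A x y * \<phi> y * (\<psi> x * (1 - d x)))
      + (\<Sum>y\<in>S. \<Sum>x\<in>S. A x y * \<psi> x * (\<phi> y * d y))"
    unfolding sum_distrib_right[symmetric] using right left by simp
  also have "(\<Sum>y\<in>S. \<Sum>x\<in>S. A x y * \<psi> x * (\<phi> y * d y))
      = (\<Sum>x\<in>S. \<Sum>y\<in>S. A x y * \<psi> x * (\<phi> y * d y))"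
    by (rule sum.swap)
  also have "(\<Sum>x\<in>S. \<Sum>y\<in>S. A x y * \<phi> y * (\<psi> x * (1 - d x))) + \<dots>
      = (\<Sum>x\<in>S. \<Sum>y\<in>S. A x y * \<psi> x * \<phi> y * (1 + d y - d x))"
    by (simp add: sum.distrib[symmetric] algebra_simps)
  also have "\<dots> \<le> (\<Sum>x\<in>S. \<Sum>y\<in>S. A x y * (\<psi> x * exp (- d x)) * (\<phi> y * exp (d y)))"
    by (intro sum_mono entry)
  finally show ?thesis .
qed

section \<open>Convexity and growth of the hyperbolic cosine\<close>

text \<open>With \<open>u\<close> the midpoint and \<open>v\<close> half the difference, the mean of
  the two values is \<open>cosh u * cosh v\<close>, and \<open>cosh v\<close> exceeds 1 unless
  \<open>v\<close> vanishes.\<close>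

lemma cosh_midpoint:
  fixes s t :: real
  shows "cosh ((s + t) / 2) \<le> (cosh s + cosh t) / 2"
    and "s \<noteq> t \<Longrightarrow> cosh ((s + t) / 2) < (cosh s + cosh t) / 2"
proof -
  define u v where "u = (s + t) / 2" and "v = (s - t) / 2"
  have st: "s = u + v" "t = u - v" by (simp_all add: u_def v_def field_simps)
  have eq: "(cosh s + cosh t) / 2 = cosh u * cosh v"
    unfolding st by (simp add: cosh_add cosh_diff)
  have u: "cosh u > 0" by simp
  show "cosh ((s + t) / 2) \<le> (cosh s + cosh t) / 2"
    unfolding eq u_def[symmetric] using u cosh_real_ge_1[of v] by simp
  show "cosh ((s + t) / 2) < (cosh s + cosh t) / 2" if "s \<noteq> t"
  proof -
    have "v \<noteq> 0" using that by (simp add: v_def)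
    then have "cosh v > 1"
      using cosh_real_ge_1[of v] cosh_real_one_iff[of v] by linarith
    then show ?thesis unfolding eq u_def[symmetric] using u by simp
  qed
qed

text \<open>Linear growth is enough to bound the edge differences on sublevel sets of the
  functional.\<close>

lemma abs_le_cosh: "\<bar>t\<bar> \<le> cosh t" for t :: real
proof -
  have *: "s \<le> cosh s" if "s \<ge> 0" for s :: real
  proof -
    \<comment> \<open>Adding the bounds for \<open>exp s\<close> and \<open>exp (- s)\<close> gives
      \<open>2 * cosh s \<ge> 2 + s\<^sup>2 / 2\<close>, which is at least \<open>2 * s\<close>
      because the square of \<open>s - 2\<close> is nonnegative.\<close>
    have "exp s \<ge> 1 + s + s\<^sup>2 / 2" using exp_lower_Taylor_quadratic[OF that] .
    moreover have "exp (- s) \<ge> 1 - s" using exp_ge_add_one_self[of "- s"] by simp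
    moreover have "s\<^sup>2 / 2 + 2 \<ge> 2 * s" using zero_le_power2[of "s - 2"] by (simp add: power2_diff)
    ultimately show ?thesis by (simp add: cosh_def)
  qed
  show ?thesis using *[of t] *[of "- t"] by (cases "t \<ge> 0") auto
qed

section \<open>Shifts and connectedness of the torus\<close>

locale torus_operator =
  fixes m :: nat and N :: "nat \<Rightarrow> nat"
    and q :: "site \<Rightarrow> real" and rp rm :: "nat \<Rightarrow> site \<Rightarrow> real"
  assumes N_pos: "\<And>\<nu>. \<nu> \<in> {1..m} \<Longrightarrow> N \<nu> > 0"
    and rp_pos: "\<And>\<nu> x. \<nu> \<in> {1..m} \<Longrightarrow> x \<in> torus m N \<Longrightarrow> rp \<nu> x > 0"
    and rm_pos: "\<And>\<nu> x. \<nu> \<in> {1..m} \<Longrightarrow> x \<in> torus m N \<Longrightarrow> rm \<nu> x > 0"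
begin

abbreviation T :: "site set" where "T \<equiv> torus m N"
abbreviation L :: "(site \<Rightarrow> real) \<Rightarrow> site \<Rightarrow> real" where "L \<equiv> generator m N q rp rm"
abbreviation F :: "(site \<Rightarrow> real) \<Rightarrow> (site \<Rightarrow> real) \<Rightarrow> real" where "F \<equiv> saddle_functional m N q rp rm"
abbreviation \<kappa> :: "site \<Rightarrow> nat \<Rightarrow> real" where "\<kappa> \<equiv> kappa N rp rm"
abbreviation \<gamma> :: "site \<Rightarrow> nat \<Rightarrow> real" where "\<gamma> \<equiv> gam N rp rm"

lemma finite_torus: "finite T"
  unfolding torus_def by (intro finite_PiE) auto

definition origin :: site where "origin = (\<lambda>\<nu>\<in>{1..m}. 0)"

lemma origin_in_torus: "origin \<in> T"
  using N_pos by (auto simp: origin_def torus_def)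

lemma shift_in_torus: "x \<in> T \<Longrightarrow> \<nu> \<in> {1..m} \<Longrightarrow> shift N \<nu> k x \<in> T"
  using N_pos[of \<nu>] by (auto simp: torus_def shift_def PiE_iff extensional_def)

lemma shift_inverse:
  assumes "x \<in> T" "\<nu> \<in> {1..m}"
  shows "shift N \<nu> 1 (shift N \<nu> (-1) x) = x" "shift N \<nu> (-1) (shift N \<nu> 1 x) = x"
proof -
  have "x \<nu> \<in> {0..<int (N \<nu>)}" using assms by (auto simp: torus_def PiE_iff)
  then show "shift N \<nu> 1 (shift N \<nu> (-1) x) = x" "shift N \<nu> (-1) (shift N \<nu> 1 x) = x"
    by (auto simp: shift_def fun_eq_iff mod_simps)
qed

lemma sum_shift:
  fixes f :: "site \<Rightarrow> real"
  assumes "\<nu> \<in> {1..m}"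
  shows "(\<Sum>x\<in>T. f (shift N \<nu> 1 x)) = (\<Sum>x\<in>T. f x)"
  by (rule sum.reindex_bij_witness[of _ "shift N \<nu> (-1)" "shift N \<nu> 1"])
    (use assms in \<open>auto simp: shift_inverse shift_in_torus\<close>)

text \<open>Connectedness of the torus: every site is reached from \<open>origin\<close> by forward
  unit steps, without wrapping around. The induction is on the sum of the coordinates.\<close>

lemma torus_induct [consumes 1, case_names origin shift]:
  assumes "x \<in> T"
    and "P origin"
    and step: "\<And>x \<nu>. x \<in> T \<Longrightarrow> \<nu> \<in> {1..m} \<Longrightarrow> P x \<Longrightarrow> P (shift N \<nu> 1 x)"
  shows "P x"
  using assms(1)
proof (induction "\<Sum>\<nu>=1..m. nat (x \<nu>)" arbitrary: x rule: less_induct)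
  case less
  have range: "x \<nu> \<in> {0..<int (N \<nu>)}" if "\<nu> \<in> {1..m}" for \<nu>
    using less.prems that by (auto simp: torus_def PiE_iff)
  show ?case
  proof (cases "\<forall>\<nu>\<in>{1..m}. x \<nu> = 0")
    case True
    then have "x = origin"
      using less.prems by (auto simp: origin_def torus_def PiE_iff extensional_def fun_eq_iff)
    then show ?thesis using \<open>P origin\<close> by simp
  next
    case False
    then obtain \<nu> where \<nu>: "\<nu> \<in> {1..m}" "x \<nu> > 0" using range by force
    \<comment> \<open>Lowering a positive coordinate by one stays within the representatives, so the
      step back from \<open>y\<close> to \<open>x\<close> involves no reduction modulo
      \<open>N \<nu>\<close>.\<close>
    define y where "y = x(\<nu> := x \<nu> - 1)"
    have "y \<mu> \<in> {0..<int (N \<mu>)}" if "\<mu> \<in> {1..m}" for \<mu>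
      using range[OF that] \<nu>(2) by (auto simp: y_def)
    then have y: "y \<in> T"
      using less.prems \<nu>(1) by (auto simp: y_def torus_def PiE_iff extensional_def)
    have "(\<Sum>\<mu>=1..m. nat (y \<mu>)) < (\<Sum>\<mu>=1..m. nat (x \<mu>))"
      using \<nu> by (intro sum_strict_mono_ex1) (auto simp: y_def)
    then have "P y" using less.hyps y by blast
    moreover have "x = shift N \<nu> 1 y"
      using range[OF \<nu>(1)] by (auto simp: shift_def y_def)
    ultimately show ?thesis using step[OF y \<nu>(1)] by simp
  qed
qed

text \<open>The triangle inequality along a path from \<open>origin\<close>. The point is that
  \<open>K\<close> depends on the torus alone, uniformly in \<open>\<eta>\<close> and
  \<open>D\<close>.\<close>

lemma oscillation_bound:
  "\<exists>K\<ge>0. \<forall>(\<eta> :: site \<Rightarrow> real) D. D \<ge> 0 \<longrightarrow>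
      (\<forall>x\<in>T. \<forall>\<nu>\<in>{1..m}. \<bar>\<eta> (shift N \<nu> 1 x) - \<eta> x\<bar> \<le> D) \<longrightarrow>
      (\<forall>x\<in>T. \<bar>\<eta> x - \<eta> origin\<bar> \<le> K * D)"
proof -
  let ?small = "\<lambda>\<eta> D. D \<ge> 0 \<and> (\<forall>x\<in>T. \<forall>\<nu>\<in>{1..m}. \<bar>\<eta> (shift N \<nu> 1 x) - \<eta> x\<bar> \<le> (D::real))"
  have "\<exists>k. k \<ge> 0 \<and> (\<forall>\<eta> D. ?small \<eta> D \<longrightarrow> \<bar>\<eta> x - \<eta> origin\<bar> \<le> k * D)" if "x \<in> T" for x
    using that
  proof (induction x rule: torus_induct)
    case origin
    show ?case by (intro exI[of _ 0]) simp
  next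
    case (shift x \<nu>)
    then obtain k where k: "k \<ge> 0" "\<And>\<eta> D. ?small \<eta> D \<Longrightarrow> \<bar>\<eta> x - \<eta> origin\<bar> \<le> k * D" by blast
    have "\<bar>\<eta> (shift N \<nu> 1 x) - \<eta> origin\<bar> \<le> (k + 1) * D" if "?small \<eta> D" for \<eta> D
    proof -
      have "\<bar>\<eta> (shift N \<nu> 1 x) - \<eta> x\<bar> \<le> D" using that shift.hyps by blast
      then show ?thesis using k(2)[OF that] by (simp add: algebra_simps)
    qed
    then show ?case using k(1) by (intro exI[of _ "k + 1"]) simp
  qed
  then obtain k where k: "\<And>x. x \<in> T \<Longrightarrow> k x \<ge> 0"
    "\<And>x \<eta> D. x \<in> T \<Longrightarrow> ?small \<eta> D \<Longrightarrow> \<bar>\<eta> x - \<eta> origin\<bar> \<le> k x * D" by metis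
  \<comment> \<open>The sum of the finitely many nonnegative \<open>k x\<close> dominates each of
    them and serves as the common constant.\<close>
  have "\<bar>\<eta> x - \<eta> origin\<bar> \<le> sum k T * D" if "?small \<eta> D" "x \<in> T" for \<eta> D x
  proof -
    have "\<bar>\<eta> x - \<eta> origin\<bar> \<le> k x * D" using k(2) that by blast
    also have "\<dots> \<le> sum k T * D"
      using that k(1) by (intro mult_right_mono member_le_sum finite_torus) auto
    finally show ?thesis .
  qed
  moreover have "sum k T \<ge> 0" using k(1) by (rule sum_nonneg)
  ultimately show ?thesis by blast
qed

section \<open>The functional as a conjugated quadratic form\<close>

text \<open>All neighbours of \<open>x\<close> lie in \<open>T\<close>, so each hop is recovered
  from its indicator by a delta sum over \<open>T\<close>.\<close>

lemma generator_eq_matrix: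
  assumes "x \<in> T"
  shows "L u x = (\<Sum>y\<in>T. matrix_entry L x y * u y)"
proof -
  have delta: "(\<Sum>y\<in>T. (c * (if z = y then 1 else 0)) * u y) = c * u z" if "z \<in> T" for c z
    using that finite_torus by (simp add: if_distrib if_distribR sum.delta cong: if_cong)
  have "(\<Sum>y\<in>T. matrix_entry L x y * u y) = (\<Sum>y\<in>T. (q x * (if x = y then 1 else 0)) * u y)
      + (\<Sum>y\<in>T. \<Sum>\<nu>=1..m. (rp \<nu> x * (if shift N \<nu> 1 x = y then 1 else 0)) * u y
          + (rm \<nu> x * (if shift N \<nu> (-1) x = y then 1 else 0)) * u y)"
    unfolding matrix_entry_def generator_def distrib_right sum_distrib_right sum.distrib ..
  also have "(\<Sum>y\<in>T. \<Sum>\<nu>=1..m. (rp \<nu> x * (if shift N \<nu> 1 x = y then 1 else 0)) * u y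
          + (rm \<nu> x * (if shift N \<nu> (-1) x = y then 1 else 0)) * u y)
      = (\<Sum>\<nu>=1..m. \<Sum>y\<in>T. (rp \<nu> x * (if shift N \<nu> 1 x = y then 1 else 0)) * u y
          + (rm \<nu> x * (if shift N \<nu> (-1) x = y then 1 else 0)) * u y)"
    by (rule sum.swap)
  also have "\<dots> = (\<Sum>\<nu>=1..m. rp \<nu> x * u (shift N \<nu> 1 x) + rm \<nu> x * u (shift N \<nu> (-1) x))"
    using assms by (intro sum.cong refl) (simp only: sum.distrib delta shift_in_torus)
  finally show ?thesis unfolding delta[OF assms] by (simp add: generator_def[of m N q rp rm u x])
qed

lemma matrix_entry_nonneg:
  assumes "x \<in> T" "x \<noteq> y"
  shows "matrix_entry L x y \<ge> 0"
  using assms rp_pos rm_pos unfolding matrix_entry_def generator_def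
  by (auto intro!: sum_nonneg add_nonneg_nonneg simp: less_imp_le)

lemma kappa_pos: "x \<in> T \<Longrightarrow> \<nu> \<in> {1..m} \<Longrightarrow> \<kappa> x \<nu> > 0"
  by (simp add: kappa_def rp_pos rm_pos shift_in_torus)

lemma kappa_cosh:
  assumes "x \<in> T" "\<nu> \<in> {1..m}"
  shows "2 * \<kappa> x \<nu> * cosh (t + \<gamma> x \<nu>) = rp \<nu> x * exp t + rm \<nu> (shift N \<nu> 1 x) * exp (- t)"
proof -
  define r s where "r = rp \<nu> x" and "s = rm \<nu> (shift N \<nu> 1 x)"
  have pos: "r > 0" "s > 0" using assms by (auto simp: r_def s_def rp_pos rm_pos shift_in_torus)
  \<comment> \<open>Moving the factor 1/2 inside the logarithm makes
    \<open>exp (\<gamma> x \<nu>)\<close> a square root, whose product or quotient with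
    \<open>\<kappa> x \<nu>\<close> is one of the two rates of the edge.\<close>
  have g: "\<gamma> x \<nu> = ln (sqrt (r / s))"
    using pos by (simp add: gam_def r_def s_def ln_sqrt)
  have e: "exp (\<gamma> x \<nu>) = sqrt (r / s)" unfolding g using pos by simp
  have k: "\<kappa> x \<nu> = sqrt r * sqrt s" by (simp add: kappa_def r_def s_def real_sqrt_mult)
  have "\<kappa> x \<nu> * exp (\<gamma> x \<nu>) = r" "\<kappa> x \<nu> * exp (- \<gamma> x \<nu>) = s"
    using pos unfolding k exp_minus e by (simp_all add: real_sqrt_divide field_simps)
  moreover have "exp (- (t + \<gamma> x \<nu>)) = exp (- t) * exp (- \<gamma> x \<nu>)"
    by (simp add: exp_add[symmetric])
  ultimately have "r * exp t + s * exp (- t) = \<kappa> x \<nu> * (exp (t + \<gamma> x \<nu>) + exp (- (t + \<gamma> x \<nu>)))"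
    unfolding exp_add[of t] by (auto simp: distrib_left mult_ac)
  then show ?thesis by (simp add: cosh_def r_def s_def)
qed

lemma saddle_functional_eq_form:
  "F b \<eta> = (\<Sum>x\<in>T. \<Sum>y\<in>T. matrix_entry L x y * (b x * exp (- \<eta> x)) * (b y * exp (\<eta> y)))"
proof -
  \<comment> \<open>The exponentials cancel in \<open>w x * u x\<close>, so the diagonal part does
    not see \<open>\<eta>\<close>.\<close>
  define w u where "w x = b x * exp (- \<eta> x)" and "u x = b x * exp (\<eta> x)" for x
  have "(\<Sum>x\<in>T. \<Sum>y\<in>T. matrix_entry L x y * w x * u y) = (\<Sum>x\<in>T. w x * L u x)"
    by (intro sum.cong refl) (simp add: generator_eq_matrix sum_distrib_left mult_ac)
  also have "\<dots> = (\<Sum>x\<in>T. q x * (w x * u x)) + (\<Sum>x\<in>T. \<Sum>\<nu>=1..m. w x * rp \<nu> x * u (shift N \<nu> 1 x))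
      + (\<Sum>x\<in>T. \<Sum>\<nu>=1..m. w x * rm \<nu> x * u (shift N \<nu> (-1) x))"
    by (simp add: generator_def sum.distrib distrib_left sum_distrib_left mult_ac)
  also have "(\<Sum>x\<in>T. \<Sum>\<nu>=1..m. w x * rm \<nu> x * u (shift N \<nu> (-1) x))
      = (\<Sum>\<nu>=1..m. \<Sum>x\<in>T. w x * rm \<nu> x * u (shift N \<nu> (-1) x))"
    by (rule sum.swap)
  \<comment> \<open>Translation by one step attaches each backward hop to the edge it traverses,
    indexed by its lower end; there it joins the forward hop, and the pair becomes one
    \<open>cosh\<close>.\<close>
  also have "\<dots> = (\<Sum>\<nu>=1..m. \<Sum>x\<in>T. w (shift N \<nu> 1 x) * rm \<nu> (shift N \<nu> 1 x) * u x)"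
  proof (rule sum.cong[OF refl])
    fix \<nu> assume "\<nu> \<in> {1..m}"
    then show "(\<Sum>x\<in>T. w x * rm \<nu> x * u (shift N \<nu> (-1) x))
        = (\<Sum>x\<in>T. w (shift N \<nu> 1 x) * rm \<nu> (shift N \<nu> 1 x) * u x)"
      using sum_shift[of \<nu> "\<lambda>x. w x * rm \<nu> x * u (shift N \<nu> (-1) x)"]
      by (simp add: shift_inverse)
  qed
  also have "\<dots> = (\<Sum>x\<in>T. \<Sum>\<nu>=1..m. w (shift N \<nu> 1 x) * rm \<nu> (shift N \<nu> 1 x) * u x)"
    by (rule sum.swap)
  also have "(\<Sum>x\<in>T. q x * (w x * u x)) + (\<Sum>x\<in>T. \<Sum>\<nu>=1..m. w x * rp \<nu> x * u (shift N \<nu> 1 x)) + \<dots>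
      = (\<Sum>x\<in>T. q x * (b x)\<^sup>2) + (\<Sum>x\<in>T. \<Sum>\<nu>=1..m. b x * b (shift N \<nu> 1 x) *
          (rp \<nu> x * exp (\<eta> (shift N \<nu> 1 x) - \<eta> x)
            + rm \<nu> (shift N \<nu> 1 x) * exp (- (\<eta> (shift N \<nu> 1 x) - \<eta> x))))"
    by (simp add: w_def u_def sum.distrib[symmetric] exp_diff exp_minus power2_eq_square field_simps)
  also have "\<dots> = F b \<eta>"
    unfolding saddle_functional_def sum_distrib_left
  proof (intro arg_cong2[where f = "(+)"] sum.cong refl)
    fix x \<nu> assume "x \<in> T" "\<nu> \<in> {1..m}"
    then show "b x * b (shift N \<nu> 1 x) * (rp \<nu> x * exp (\<eta> (shift N \<nu> 1 x) - \<eta> x)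
          + rm \<nu> (shift N \<nu> 1 x) * exp (- (\<eta> (shift N \<nu> 1 x) - \<eta> x)))
        = 2 * (\<kappa> x \<nu> * b x * b (shift N \<nu> 1 x)
            * cosh (\<eta> (shift N \<nu> 1 x) - \<eta> x + \<gamma> x \<nu>))"
      by (subst kappa_cosh[symmetric]) (simp_all only: mult_ac)
  qed
  finally show ?thesis by (simp add: w_def u_def)
qed

section \<open>Existence and uniqueness of the minimizer\<close>

text \<open>Only differences along edges inside \<open>T\<close> enter the functional; in
  particular, values off \<open>T\<close> are irrelevant.\<close>

lemma saddle_functional_add_const:
  assumes "\<And>x. x \<in> T \<Longrightarrow> \<eta>' x = \<eta> x + c"
  shows "F a \<eta>' = F a \<eta>"
  unfolding saddle_functional_def using assms
  by (intro arg_cong2[where f = "(+)"] arg_cong2[where f = "(*)"] sum.cong refl)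
    (simp add: shift_in_torus)

lemma center_in_potentials:
  "(\<lambda>x\<in>T. \<eta> x - (\<Sum>y\<in>T. \<eta> y) / real (card T)) \<in> potentials m N"
proof -
  have "card T > 0" using origin_in_torus finite_torus by (auto simp: card_gt_0_iff)
  then show ?thesis by (simp add: potentials_def sum_subtractf)
qed

text \<open>Centring a competitor does not change its value. This admits competitors outside
  \<open>potentials\<close>, such as single-site perturbations.\<close>

lemma arg_min_global:
  assumes "is_arg_min (F a) (\<lambda>\<eta>. \<eta> \<in> potentials m N) \<beta>"
  shows "F a \<beta> \<le> F a \<eta>"
proof -
  let ?\<eta> = "\<lambda>x\<in>T. \<eta> x - (\<Sum>y\<in>T. \<eta> y) / real (card T)"
  have "F a \<beta> \<le> F a ?\<eta>"
    using assms center_in_potentials[of \<eta>] unfolding is_arg_min_linorder by blast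
  also have "F a ?\<eta> = F a \<eta>"
    by (rule saddle_functional_add_const[of _ _ "- ((\<Sum>y\<in>T. \<eta> y) / real (card T))"]) simp
  finally show ?thesis .
qed

text \<open>Continuity refers to the product topology on functions: \<open>F a\<close> combines
  finitely many coordinate evaluations.\<close>

lemma continuous_saddle_functional: "continuous_on A (F a)"
  unfolding saddle_functional_def
  by (intro continuous_intros continuous_on_subset[OF continuous_on_product_coordinates subset_UNIV])

text \<open>Every function whose value is at most that of 0 lies, after subtracting its value at
  \<open>origin\<close>, in one fixed compact box, so the minimum over the box is global.\<close>

lemma global_min_exists:
  assumes a: "\<And>x. x \<in> T \<Longrightarrow> a x > 0"
  shows "\<exists>\<beta>. \<forall>\<eta>. F a \<beta> \<le> F a \<eta>"
proof -
  define w where "w x \<nu> = \<kappa> x \<nu> * a x * a (shift N \<nu> 1 x)" for x \<nu>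
  have w: "w x \<nu> > 0" if "x \<in> T" "\<nu> \<in> {1..m}" for x \<nu>
    using that a by (simp add: w_def kappa_pos shift_in_torus)
  \<comment> \<open>\<open>B\<close> is the \<open>cosh\<close> part of the functional at 0, hence a
    bound for this part on the whole sublevel set.\<close>
  define B where "B = F a (\<lambda>_. 0) - (\<Sum>x\<in>T. q x * (a x)\<^sup>2)"
  have B: "B \<ge> 0"
    unfolding B_def saddle_functional_def w_def[symmetric]
    by (auto intro!: sum_nonneg simp: w less_imp_le)
  \<comment> \<open>Each summand bounds the difference across its edge; the sum over all edges is a
    uniform bound.\<close>
  define D where "D = (\<Sum>x\<in>T. \<Sum>\<nu>=1..m. B / w x \<nu> + \<bar>\<gamma> x \<nu>\<bar>)"
  have nn: "B / w x \<nu> + \<bar>\<gamma> x \<nu>\<bar> \<ge> 0" if "x \<in> T" "\<nu> \<in> {1..m}" for x \<nu>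
    using w[OF that] B by simp
  have D: "D \<ge> 0" unfolding D_def by (intro sum_nonneg nn)
  obtain K :: real where K: "K \<ge> 0" and osc: "\<forall>\<eta> D. D \<ge> 0 \<longrightarrow>
      (\<forall>x\<in>T. \<forall>\<nu>\<in>{1..m}. \<bar>\<eta> (shift N \<nu> 1 x) - \<eta> x\<bar> \<le> D) \<longrightarrow>
      (\<forall>x\<in>T. \<bar>\<eta> x - \<eta> origin\<bar> \<le> K * D)"
    using oscillation_bound by blast
  have bounded: "\<bar>\<eta> x - \<eta> origin\<bar> \<le> K * D" if le: "F a \<eta> \<le> F a (\<lambda>_. 0)" and x: "x \<in> T" for \<eta> x
  proof (rule osc[rule_format, OF D _ x])
    fix x \<nu> assume x: "x \<in> T" and \<nu>: "\<nu> \<in> {1..m}"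
    define t where "t = \<eta> (shift N \<nu> 1 x) - \<eta> x"
    have "w x \<nu> * \<bar>t + \<gamma> x \<nu>\<bar> \<le> w x \<nu> * cosh (t + \<gamma> x \<nu>)"
      using w[OF x \<nu>] by (intro mult_left_mono abs_le_cosh) simp
    also have "\<dots> \<le> (\<Sum>\<nu>=1..m. w x \<nu> * cosh (\<eta> (shift N \<nu> 1 x) - \<eta> x + \<gamma> x \<nu>))"
      unfolding t_def using x \<nu> by (intro member_le_sum) (auto simp: w less_imp_le)
    also have "\<dots> \<le> (\<Sum>x\<in>T. \<Sum>\<nu>=1..m. w x \<nu> * cosh (\<eta> (shift N \<nu> 1 x) - \<eta> x + \<gamma> x \<nu>))"
      using x by (intro member_le_sum[of x T "\<lambda>x. \<Sum>\<nu>=1..m. w x \<nu> * cosh (\<eta> (shift N \<nu> 1 x) - \<eta> x + \<gamma> x \<nu>)"] finite_torus)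
         (auto intro!: sum_nonneg simp: w less_imp_le)
    \<comment> \<open>Doubling a nonnegative sum restores the factor 2 of the functional.\<close>
    also have "\<dots> \<le> 2 * \<dots>"
      by (auto intro!: sum_nonneg simp: w less_imp_le)
    also have "\<dots> \<le> B"
      using le unfolding B_def saddle_functional_def w_def by simp
    finally have "\<bar>t + \<gamma> x \<nu>\<bar> \<le> B / w x \<nu>"
      using w[OF x \<nu>] by (simp add: field_simps)
    then have "\<bar>t\<bar> \<le> B / w x \<nu> + \<bar>\<gamma> x \<nu>\<bar>" by linarith
    also have "\<dots> \<le> (\<Sum>\<nu>=1..m. B / w x \<nu> + \<bar>\<gamma> x \<nu>\<bar>)"
      using x \<nu> nn by (intro member_le_sum[of \<nu> _ "\<lambda>\<nu>. B / w x \<nu> + \<bar>\<gamma> x \<nu>\<bar>"]) auto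
    also have "\<dots> \<le> D"
      unfolding D_def using x nn
      by (intro member_le_sum[of x T "\<lambda>x. \<Sum>\<nu>=1..m. B / w x \<nu> + \<bar>\<gamma> x \<nu>\<bar>"] finite_torus sum_nonneg) auto
    finally show "\<bar>\<eta> (shift N \<nu> 1 x) - \<eta> x\<bar> \<le> D" by (simp add: t_def)
  qed
  \<comment> \<open>Off the torus the coordinates are pinned to 0, so that Tychonoff makes the box compact.\<close>
  define Q where "Q = (\<Pi>\<^sub>E x\<in>UNIV. if x \<in> T then {- (K * D)..K * D} else {0})"
  have "compact Q"
    unfolding Q_def compactin_euclidean_iff[symmetric] euclidean_product_topology[symmetric]
    by (subst compactin_PiE) auto
  moreover have zero: "(\<lambda>_. 0) \<in> Q" using K D by (auto simp: Q_def)
  ultimately obtain \<beta> where \<beta>: "\<beta> \<in> Q" "\<And>\<eta>. \<eta> \<in> Q \<Longrightarrow> F a \<beta> \<le> F a \<eta>"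
    using continuous_attains_inf[OF _ _ continuous_saddle_functional] by (metis empty_iff)
  \<comment> \<open>A function in the sublevel set of 0 is translated into the box; any other one
    loses to 0, which lies in the box.\<close>
  have "F a \<beta> \<le> F a \<eta>" for \<eta>
  proof (cases "F a \<eta> \<le> F a (\<lambda>_. 0)")
    case True
    define \<eta>' where "\<eta>' x = (if x \<in> T then \<eta> x - \<eta> origin else 0)" for x
    have "- (K * D) \<le> \<eta> x - \<eta> origin \<and> \<eta> x - \<eta> origin \<le> K * D" if "x \<in> T" for x
      using bounded[OF True that] by linarith
    then have "\<eta>' \<in> Q" by (auto simp: Q_def \<eta>'_def)
    moreover have "F a \<eta>' = F a \<eta>"
      by (rule saddle_functional_add_const[of _ _ "- \<eta> origin"]) (simp add: \<eta>'_def)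
    ultimately show ?thesis using \<beta>(2) by metis
  next
    case False
    then show ?thesis using \<beta>(2)[OF zero] by simp
  qed
  then show ?thesis by blast
qed

text \<open>If two minimizers differed in a single edge difference, their midpoint would be strictly
  better. So they differ by a constant, which the zero mean forces to vanish; extensionality settles
  the values off \<open>T\<close>.\<close>

lemma arg_min_unique:
  assumes a: "\<And>x. x \<in> T \<Longrightarrow> a x > 0"
    and 1: "is_arg_min (F a) (\<lambda>\<eta>. \<eta> \<in> potentials m N) \<beta>"
    and 2: "is_arg_min (F a) (\<lambda>\<eta>. \<eta> \<in> potentials m N) \<beta>'"
  shows "\<beta> = \<beta>'"
proof -
  define w where "w x \<nu> = \<kappa> x \<nu> * a x * a (shift N \<nu> 1 x)" for x \<nu>
  have w: "w x \<nu> > 0" if "x \<in> T" "\<nu> \<in> {1..m}" for x \<nu>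
    using that a by (simp add: w_def kappa_pos shift_in_torus)
  define t where "t \<eta> x \<nu> = \<eta> (shift N \<nu> 1 x) - \<eta> x + \<gamma> x \<nu>" for \<eta> x \<nu>
  \<comment> \<open>A single sum over all edges lets strictness at one edge carry over to the
    total.\<close>
  define G where "G \<eta> = (\<Sum>(x, \<nu>)\<in>T \<times> {1..m}. w x \<nu> * cosh (t \<eta> x \<nu>))" for \<eta>
  have FG: "F a \<eta> = (\<Sum>x\<in>T. q x * (a x)\<^sup>2) + 2 * G \<eta>" for \<eta>
    by (simp add: saddle_functional_def G_def w_def t_def sum.cartesian_product)
  define h where "h x = (\<beta> x + \<beta>' x) / 2" for x
  have tm: "t h x \<nu> = (t \<beta> x \<nu> + t \<beta>' x \<nu>) / 2" for x \<nu>
    by (simp add: t_def h_def field_simps)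
  have edge: "t \<beta> x \<nu> = t \<beta>' x \<nu>" if x: "x \<in> T" and \<nu>: "\<nu> \<in> {1..m}" for x \<nu>
  proof (rule ccontr)
    assume ne: "t \<beta> x \<nu> \<noteq> t \<beta>' x \<nu>"
    have "G h < (\<Sum>(x, \<nu>)\<in>T \<times> {1..m}. w x \<nu> * ((cosh (t \<beta> x \<nu>) + cosh (t \<beta>' x \<nu>)) / 2))"
      unfolding G_def
    proof (rule sum_strict_mono_ex1)
      show "finite (T \<times> {1..m})" using finite_torus by simp
      show "\<forall>p\<in>T \<times> {1..m}. (case p of (x, \<nu>) \<Rightarrow> w x \<nu> * cosh (t h x \<nu>))
          \<le> (case p of (x, \<nu>) \<Rightarrow> w x \<nu> * ((cosh (t \<beta> x \<nu>) + cosh (t \<beta>' x \<nu>)) / 2))"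
        unfolding tm using w cosh_midpoint(1)
        by (auto intro!: mult_left_mono simp del: times_divide_eq_right simp: less_imp_le)
      have "w x \<nu> * cosh (t h x \<nu>) < w x \<nu> * ((cosh (t \<beta> x \<nu>) + cosh (t \<beta>' x \<nu>)) / 2)"
        unfolding tm by (intro mult_strict_left_mono cosh_midpoint(2) ne w x \<nu>)
      then show "\<exists>p\<in>T \<times> {1..m}. (case p of (x, \<nu>) \<Rightarrow> w x \<nu> * cosh (t h x \<nu>))
          < (case p of (x, \<nu>) \<Rightarrow> w x \<nu> * ((cosh (t \<beta> x \<nu>) + cosh (t \<beta>' x \<nu>)) / 2))"
        using x \<nu> by (intro bexI[of _ "(x, \<nu>)"]) auto
    qed
    also have "\<dots> = (G \<beta> + G \<beta>') / 2"
      unfolding G_def sum.distrib[symmetric] sum_divide_distrib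
      by (intro sum.cong refl) (auto simp: field_simps)
    finally have "G h < (G \<beta> + G \<beta>') / 2" .
    moreover have "G \<beta> \<le> G h" "G \<beta>' \<le> G h"
      using arg_min_global[OF 1, of h] arg_min_global[OF 2, of h] by (simp_all add: FG)
    ultimately show False by simp
  qed
  define \<delta> where "\<delta> x = \<beta> x - \<beta>' x" for x
  \<comment> \<open>Equal edge differences make \<open>\<delta>\<close> invariant under unit shifts,
    hence constant by connectedness.\<close>
  have const: "\<delta> x = \<delta> origin" if "x \<in> T" for x
    using that
  proof (induction x rule: torus_induct)
    case (shift x \<nu>)
    then show ?case using edge[of x \<nu>] by (simp add: \<delta>_def t_def)
  qed simp
  have pot: "\<beta> \<in> potentials m N" "\<beta>' \<in> potentials m N"
    using 1 2 by (auto simp: is_arg_min_def)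
  have "(\<Sum>x\<in>T. \<delta> x) = 0"
    using pot by (simp add: \<delta>_def sum_subtractf potentials_def)
  then have "real (card T) * \<delta> origin = 0"
    using const by simp
  then have "\<delta> origin = 0"
    using origin_in_torus finite_torus by auto
  then have "\<beta> x = \<beta>' x" if "x \<in> T" for x
    using const[OF that] by (simp add: \<delta>_def)
  then show ?thesis
    using pot by (intro extensionalityI[of _ T]) (auto simp: potentials_def PiE_iff)
qed

lemma arg_min_ex1:
  assumes a: "\<And>x. x \<in> T \<Longrightarrow> a x > 0"
  shows "\<exists>!\<beta>. is_arg_min (F a) (\<lambda>\<eta>. \<eta> \<in> potentials m N) \<beta>"
proof -
  obtain \<beta> where \<beta>: "\<And>\<eta>. F a \<beta> \<le> F a \<eta>" using global_min_exists[of a] a by blast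
  let ?\<beta> = "\<lambda>x\<in>T. \<beta> x - (\<Sum>y\<in>T. \<beta> y) / real (card T)"
  have "F a ?\<beta> = F a \<beta>"
    by (rule saddle_functional_add_const[of _ _ "- ((\<Sum>y\<in>T. \<beta> y) / real (card T))"]) simp
  then have "is_arg_min (F a) (\<lambda>\<eta>. \<eta> \<in> potentials m N) ?\<beta>"
    unfolding is_arg_min_linorder using \<beta> center_in_potentials[of \<beta>] by simp
  then show ?thesis using arg_min_unique[of a] a by blast
qed

section \<open>Stationarity and the edge flux\<close>

lemma arg_min_divergence_free:
  assumes min: "is_arg_min (F a) (\<lambda>\<eta>. \<eta> \<in> potentials m N) \<beta>" and x: "x \<in> T"
  shows "(\<Sum>\<nu>=1..m. edge_flux N rp rm a \<beta> x \<nu> - edge_flux N rp rm a \<beta> (shift N \<nu> (-1) x) \<nu>) = 0"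
proof -
  define e :: "site \<Rightarrow> real" where "e y = (if y = x then 1 else 0)" for y
  define J where "J = edge_flux N rp rm a \<beta>"
  let ?f = "\<lambda>s. F a (\<lambda>y. \<beta> y + s * e y)"
  \<comment> \<open>Differentiating \<open>cosh\<close> gives \<open>sinh\<close>, so each edge
    contributes its flux times the difference of \<open>e\<close> across it.\<close>
  have der: "(?f has_real_derivative 2 * (\<Sum>y\<in>T. \<Sum>\<nu>=1..m. J y \<nu> * (e (shift N \<nu> 1 y) - e y))) (at 0)"
    unfolding saddle_functional_def
    by (auto intro!: derivative_eq_intros sum.cong simp: J_def edge_flux_def algebra_simps)
  have "?f 0 \<le> ?f s" for s using arg_min_global[OF min] by simp
  then have "2 * (\<Sum>y\<in>T. \<Sum>\<nu>=1..m. J y \<nu> * (e (shift N \<nu> 1 y) - e y)) = 0"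
    by (intro DERIV_local_min[OF der zero_less_one]) simp
  then have "0 = (\<Sum>y\<in>T. \<Sum>\<nu>=1..m. J y \<nu> * (e (shift N \<nu> 1 y) - e y))" by simp
  also have "\<dots> = (\<Sum>\<nu>=1..m. \<Sum>y\<in>T. J y \<nu> * (e (shift N \<nu> 1 y) - e y))" by (rule sum.swap)
  also have "\<dots> = (\<Sum>\<nu>=1..m. J (shift N \<nu> (-1) x) \<nu> - J x \<nu>)"
  proof (rule sum.cong[OF refl])
    fix \<nu> assume \<nu>: "\<nu> \<in> {1..m}"
    have delta: "(\<Sum>y\<in>T. g y * e y) = g x" for g
      using x finite_torus by (simp add: e_def if_distrib sum.delta cong: if_cong)
    \<comment> \<open>Summation by parts: the summand is written as a function of the shifted site,
      and translation invariance leaves the flux on the edge entering \<open>x\<close>.\<close>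
    have "(\<Sum>y\<in>T. J y \<nu> * e (shift N \<nu> 1 y))
        = (\<Sum>y\<in>T. (\<lambda>z. J (shift N \<nu> (-1) z) \<nu> * e z) (shift N \<nu> 1 y))"
      using \<nu> by (intro sum.cong refl) (simp add: shift_inverse)
    also have "\<dots> = J (shift N \<nu> (-1) x) \<nu>"
      unfolding sum_shift[OF \<nu>, of "\<lambda>z. J (shift N \<nu> (-1) z) \<nu> * e z"] by (rule delta)
    finally show "(\<Sum>y\<in>T. J y \<nu> * (e (shift N \<nu> 1 y) - e y)) = J (shift N \<nu> (-1) x) \<nu> - J x \<nu>"
      by (simp add: right_diff_distrib sum_subtractf delta)
  qed
  finally show ?thesis by (simp add: J_def sum_subtractf)
qed

section \<open>The saddle point given by the eigenvectors\<close>

text \<open>The definitions of \<open>a\<close> and \<open>\<beta>\<close> invert the conjugation: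
  \<open>a x * exp (\<beta> x)\<close> is \<open>\<phi> x\<close> and
  \<open>a x * exp (- \<beta> x)\<close> is \<open>\<psi> x\<close>. Both Metzler bounds then apply,
  and at the pair itself they squeeze the value to \<open>\<Lambda>\<close>.\<close>

lemma eigenvector_saddle:
  assumes pos: "\<And>x. x \<in> T \<Longrightarrow> \<phi> x > 0 \<and> \<psi> x > 0"
    and right: "\<And>x. x \<in> T \<Longrightarrow> L \<phi> x = \<Lambda> * \<phi> x"
    and left: "\<And>x. x \<in> T \<Longrightarrow> transpose_op T L \<psi> x = \<Lambda> * \<psi> x"
    and norm: "(\<Sum>x\<in>T. \<phi> x * \<psi> x) = 1"
    and a: "a = (\<lambda>x\<in>T. sqrt (\<phi> x * \<psi> x))"
    and \<beta>: "\<beta> = (\<lambda>x\<in>T. (1/2) * ln (\<phi> x / \<psi> x))"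
  shows "F a \<beta> = \<Lambda>"
    and "b \<in> amplitudes m N \<Longrightarrow> F b \<beta> \<le> \<Lambda>"
    and "\<Lambda> \<le> F a \<eta>"
proof -
  have right': "(\<Sum>y\<in>T. matrix_entry L x y * \<phi> y) = \<Lambda> * \<phi> x" if "x \<in> T" for x
    using right[OF that] generator_eq_matrix[OF that] by simp
  have left': "(\<Sum>x\<in>T. matrix_entry L x y * \<psi> x) = \<Lambda> * \<psi> y" if "y \<in> T" for y
    using left[OF that] by (simp add: transpose_op_def)
  have a_pos: "a x > 0" if "x \<in> T" for x using pos[OF that] that by (simp add: a)
  have exp_\<beta>: "a x * exp (\<beta> x) = \<phi> x" "a x * exp (- \<beta> x) = \<psi> x" if "x \<in> T" for x
  proof -
    have e: "exp (\<beta> x) = sqrt (\<phi> x / \<psi> x)"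
      using pos[OF that] that by (simp add: \<beta> ln_sqrt[symmetric])
    show "a x * exp (\<beta> x) = \<phi> x" "a x * exp (- \<beta> x) = \<psi> x"
      using pos[OF that] that unfolding exp_minus e
      by (simp_all add: a real_sqrt_mult real_sqrt_divide field_simps)
  qed
  have upper: "F b \<beta> \<le> \<Lambda>" if "(\<Sum>x\<in>T. (b x)\<^sup>2) = 1" for b
  proof -
    define c where "c x = b x / a x" for x
    have b: "b x = c x * a x" if "x \<in> T" for x using a_pos[OF that] by (simp add: c_def)
    have "F b \<beta> = (\<Sum>x\<in>T. \<Sum>y\<in>T. matrix_entry L x y * (c x * \<psi> x) * (c y * \<phi> y))"
      unfolding saddle_functional_eq_form
      by (intro sum.cong refl) (simp add: b exp_\<beta> mult.assoc)
    also have "\<dots> \<le> \<Lambda> * (\<Sum>x\<in>T. (c x)\<^sup>2 * (\<phi> x * \<psi> x))"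
      using pos right' left' by (intro metzler_form_le matrix_entry_nonneg) (auto simp: less_imp_le)
    also have "(\<Sum>x\<in>T. (c x)\<^sup>2 * (\<phi> x * \<psi> x)) = (\<Sum>x\<in>T. (b x)\<^sup>2)"
    proof (rule sum.cong[OF refl])
      fix x assume "x \<in> T"
      then show "(c x)\<^sup>2 * (\<phi> x * \<psi> x) = (b x)\<^sup>2"
        using pos[of x] unfolding b[OF \<open>x \<in> T\<close>] by (simp add: power_mult_distrib a)
    qed
    finally show ?thesis using that by simp
  qed
  show lower: "\<Lambda> \<le> F a \<eta>" for \<eta>
  proof -
    define d where "d x = \<eta> x - \<beta> x" for x
    have "\<Lambda> = \<Lambda> * (\<Sum>x\<in>T. \<phi> x * \<psi> x)" by (simp add: norm)
    also have "\<dots> \<le> (\<Sum>x\<in>T. \<Sum>y\<in>T. matrix_entry L x y * (\<psi> x * exp (- d x)) * (\<phi> y * exp (d y)))"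
      using pos right' left' by (intro metzler_form_ge matrix_entry_nonneg) (auto simp: less_imp_le)
    also have "\<dots> = F a \<eta>"
    proof -
      have "\<psi> x * exp (- d x) = a x * exp (- \<eta> x)" "\<phi> x * exp (d x) = a x * exp (\<eta> x)"
        if "x \<in> T" for x
        using exp_\<beta>[OF that] by (auto simp: d_def mult.assoc exp_add[symmetric] simp flip: exp_\<beta>[OF that])
      then show ?thesis unfolding saddle_functional_eq_form by simp
    qed
    finally show ?thesis .
  qed
  \<comment> \<open>The scaling of the eigenvectors normalizes \<open>a\<close>, so the upper bound
    may be used with \<open>b\<close> equal to \<open>a\<close>.\<close>
  have "(\<Sum>x\<in>T. (a x)\<^sup>2) = (\<Sum>x\<in>T. \<phi> x * \<psi> x)"
    by (intro sum.cong refl) (use pos in \<open>simp add: a less_imp_le\<close>)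
  then show "F a \<beta> = \<Lambda>"
    using upper[of a] lower[of \<beta>] norm by simp
  show "F b \<beta> \<le> \<Lambda>" if "b \<in> amplitudes m N"
    using that upper by (simp add: amplitudes_def)
qed

text \<open>The two scaling conditions on the eigenvectors are precisely the two constraints: unit
  norm for the amplitude and zero mean for the potential.\<close>

lemma eigenvector_pair_admissible:
  assumes pos: "\<And>x. x \<in> T \<Longrightarrow> \<phi> x > 0 \<and> \<psi> x > 0"
  shows "(\<Sum>x\<in>T. \<phi> x * \<psi> x) = 1 \<Longrightarrow> (\<lambda>x\<in>T. sqrt (\<phi> x * \<psi> x)) \<in> amplitudes m N"
    and "(\<Sum>x\<in>T. ln (\<phi> x / \<psi> x)) = 0 \<Longrightarrow> (\<lambda>x\<in>T. (1/2) * ln (\<phi> x / \<psi> x)) \<in> potentials m N"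
  using pos unfolding amplitudes_def potentials_def
  by (auto simp: sum_divide_distrib[symmetric] less_imp_le cong: sum.cong)

end

theorem mainTheorem2:
  fixes m :: nat and N :: "nat \<Rightarrow> nat"
    and q :: "site \<Rightarrow> real" and rp rm :: "nat \<Rightarrow> site \<Rightarrow> real"
  assumes "m \<ge> 1"
    and "\<forall>\<nu>\<in>{1..m}. N \<nu> \<ge> 3"
    and "\<forall>\<nu>\<in>{1..m}. \<forall>x\<in>torus m N. rp \<nu> x > 0"
    and "\<forall>\<nu>\<in>{1..m}. \<forall>x\<in>torus m N. rm \<nu> x > 0"
  shows
    "(\<forall>a\<in>amplitudes m N.
        \<exists>!\<beta>. is_arg_min (saddle_functional m N q rp rm a) (\<lambda>\<eta>. \<eta> \<in> potentials m N) \<beta>)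
     \<and>
     (\<forall>\<phi> \<psi> a \<beta>.
        (\<forall>x\<in>torus m N. \<phi> x > 0 \<and> \<psi> x > 0) \<longrightarrow>
        (\<forall>x\<in>torus m N. generator m N q rp rm \<phi> x =
            spectral_bound (torus m N) (generator m N q rp rm) * \<phi> x) \<longrightarrow>
        (\<forall>x\<in>torus m N. transpose_op (torus m N) (generator m N q rp rm) \<psi> x =
            spectral_bound (torus m N) (generator m N q rp rm) * \<psi> x) \<longrightarrow>
        (\<Sum>x\<in>torus m N. \<phi> x * \<psi> x) = 1 \<longrightarrow>
        (\<Sum>x\<in>torus m N. ln (\<phi> x / \<psi> x)) = 0 \<longrightarrow>
        a = (\<lambda>x\<in>torus m N. sqrt (\<phi> x * \<psi> x)) \<longrightarrow>
        \<beta> = (\<lambda>x\<in>torus m N. (1/2) * ln (\<phi> x / \<psi> x)) \<longrightarrow>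
          a \<in> amplitudes m N \<and> \<beta> \<in> potentials m N \<and>
          saddle_functional m N q rp rm a \<beta> =
            spectral_bound (torus m N) (generator m N q rp rm) \<and>
          (\<forall>b\<in>amplitudes m N.
             saddle_functional m N q rp rm b \<beta> \<le> saddle_functional m N q rp rm a \<beta>) \<and>
          (\<forall>\<eta>\<in>potentials m N.
             spectral_bound (torus m N) (generator m N q rp rm)
               \<le> saddle_functional m N q rp rm a \<eta>))
     \<and>
     (\<forall>a\<in>amplitudes m N. \<forall>\<beta>.
        is_arg_min (saddle_functional m N q rp rm a) (\<lambda>\<eta>. \<eta> \<in> potentials m N) \<beta> \<longrightarrow>
        (\<forall>x\<in>torus m N.
           (\<Sum>\<nu>=1..m. edge_flux N rp rm a \<beta> x \<nu>
                       - edge_flux N rp rm a \<beta> (shift N \<nu> (-1) x) \<nu>) = 0))"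
proof -
  interpret torus_operator m N q rp rm
    using assms by unfold_locales force+
  have pos: "a x > 0" if "a \<in> amplitudes m N" "x \<in> T" for a x
    using that by (auto simp: amplitudes_def PiE_iff)
  show ?thesis
  \<comment> \<open>The seven goals are the unique minimizer, the two memberships, the saddle value,
    the upper and the lower inequality, and the divergence condition.\<close>
  proof (intro conjI ballI allI impI, goal_cases)
    case (1 a)
    then show ?case using arg_min_ex1 pos by blast
  next
    case (2 \<phi> \<psi> a \<beta>)
    then show ?case using eigenvector_pair_admissible(1)[of \<phi> \<psi>] by simp
  next
    case (3 \<phi> \<psi> a \<beta>)
    then show ?case using eigenvector_pair_admissible(2)[of \<phi> \<psi>] by simp
  next
    case (4 \<phi> \<psi> a \<beta>)
    then show ?case by (intro eigenvector_saddle(1)) auto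
  next
    case (5 \<phi> \<psi> a \<beta> b)
    have "F a \<beta> = spectral_bound T L"
      using 5 by (intro eigenvector_saddle(1)) auto
    moreover have "F b \<beta> \<le> spectral_bound T L"
      using 5 by (intro eigenvector_saddle(2)[of \<phi> \<psi>]) auto
    ultimately show ?case by simp
  next
    case (6 \<phi> \<psi> a \<beta> \<eta>)
    then show ?case by (intro eigenvector_saddle(3)) auto
  next
    case (7 a \<beta> x)
    then show ?case by (intro arg_min_divergence_free)
  qed
qed

end
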